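(* Let $p(x,y,z)$ be a trivariate homogeneous polynomial with nonnegative (real) coefficients. If $p(x,y,z)$ is stable and symmetric in $x$ and $y$, then $p(x,y,z)$ is partial $\gamma$-positive.
   Context: A polynomial $f\in\mathbb{R}[x_1,\ldots,x_n]$ is stable if either $f(x_1,\ldots,x_n)\neq0$ for all complex $x_1,\ldots,x_n$ with $\mathrm{Im}(x_i)>0$ for all $i$, or $f$ is identically zero. "Symmetric in $x$ and $y$" means $p(x,y,z)=p(y,x,z)$. A bivariate polynomial $h(x,y)$ is homogeneous $\gamma$-positive if, for some integer $N\ge 0$, it can be written as $h(x,y)=\sum_{k=0}^{\lfloor N/2\rfloor}\gamma_k(xy)^k(x+y)^{N-2k}$ with all $\gamma_k\ge0$ (in particular the zero polynomial is homogeneous $\gamma$-positive). A trivariate polynomial $p(x,y,z)=\sum_i s_i(x,y)z^i$ is partial $\gamma$-positive if every $s_i(x,y)$ is homogeneous $\gamma$-positive. *)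

theory Defs
  imports Complex_Main "HOL-Computational_Algebra.Polynomial"
begin

(* R[x,y] is represented by the iterated polynomial ring R[x][y] = "real poly poly" and R[x,y,z]
   by R[x][y][z] = "real poly poly poly": the outermost variable is z and the innermost is x.
   So coeff p k is the polynomial s_k(x,y) in p = (SUM k. s_k(x,y) z^k). *)

type_synonym bipoly = "real poly poly"
type_synonym tripoly = "real poly poly poly"

(* The coefficient of x^i y^j z^k. *)
definition coeff3 :: "tripoly \<Rightarrow> nat \<Rightarrow> nat \<Rightarrow> nat \<Rightarrow> real" where
  "coeff3 p i j k = coeff (coeff (coeff p k) j) i"

(* p(a,b,c) for a, b, c in a commutative ring, where the embedding e carries the real
   coefficients into that ring. *)
definition eval3 :: "(real \<Rightarrow> 'a::comm_ring_1) \<Rightarrow> tripoly \<Rightarrow> 'a \<Rightarrow> 'a \<Rightarrow> 'a \<Rightarrow> 'a" where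
  "eval3 e p a b c =
     poly (map_poly (\<lambda>s. poly (map_poly (\<lambda>r. poly (map_poly e r) a) s) b) p) c"

definition stable3 :: "tripoly \<Rightarrow> bool" where
  "stable3 p \<longleftrightarrow>
     (\<forall>x y z. Im x > 0 \<and> Im y > 0 \<and> Im z > 0 \<longrightarrow> eval3 complex_of_real p x y z \<noteq> 0) \<or> p = 0"

(* By this convention the zero polynomial is homogeneous. *)
definition homogeneous3 :: "tripoly \<Rightarrow> bool" where
  "homogeneous3 p \<longleftrightarrow> (\<exists>d. \<forall>i j k. coeff3 p i j k \<noteq> 0 \<longrightarrow> i + j + k = d)"

definition nonneg_coeffs3 :: "tripoly \<Rightarrow> bool" where
  "nonneg_coeffs3 p \<longleftrightarrow> (\<forall>i j k. coeff3 p i j k \<ge> 0)"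

(* The polynomial p(y,x,z), obtained by substituting the variables y, x, z for x, y, z, equals p. *)
definition symmetric_xy :: "tripoly \<Rightarrow> bool" where
  "symmetric_xy p \<longleftrightarrow>
     (let x = [:[:[:0, 1:]:]:]; y = [:[:0, 1:]:]; z = [:0, 1:]
      in p = eval3 (\<lambda>c. [:[:[:c:]:]:]) p y x z)"

definition homogeneous_gamma_positive :: "bipoly \<Rightarrow> bool" where
  "homogeneous_gamma_positive h \<longleftrightarrow>
     (let x = [:[:0, 1:]:]; y = [:0, 1:]
      in \<exists>(N::nat) (\<gamma>::nat \<Rightarrow> real). (\<forall>k \<le> N div 2. \<gamma> k \<ge> 0) \<and>
           h = (\<Sum>k = 0..N div 2. [:[:\<gamma> k:]:] * (x * y) ^ k * (x + y) ^ (N - 2 * k)))"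

definition partial_gamma_positive :: "tripoly \<Rightarrow> bool" where
  "partial_gamma_positive p \<longleftrightarrow> (\<forall>i. homogeneous_gamma_positive (coeff p i))"

end

theory Submission
  imports Defs "HOL-Complex_Analysis.Complex_Analysis"
    "HOL-Computational_Algebra.Fundamental_Theorem_Algebra"
begin

text \<open>
  Write \<open>p = (\<Sum>k. s\<^sub>k(x, y) z^k)\<close>. Each \<open>s\<^sub>k\<close> is homogeneous, so it is determined by the real
  polynomial \<open>A\<^sub>k(t) = s\<^sub>k(t, 1)\<close>, which has nonnegative coefficients and is palindromic because
  \<open>p\<close> is symmetric. Two facts give the theorem.

  First, \<open>A\<^sub>k\<close> is zero or has only real roots (\<open>stable3_coeff\<close>). By homogeneity, stability of \<open>p\<close>
  holds for every open half-plane whose boundary passes through 0, not only for the upper one.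
  For \<open>Im t > 0\<close> one such half-plane contains \<open>t\<close>, 1 and all positive reals, so \<open>p(t, 1, z)\<close> has
  no zero \<open>z\<close> in it. By the argument of the Gauss-Lucas theorem (\<open>higher_pderiv_half_plane\<close>) the
  same holds for the derivatives in \<open>z\<close>. As \<open>z\<close> tends to 0 along the positive reals, the
  derivative of order \<open>k\<close> tends to \<open>k! A\<^sub>k(t)\<close>, and Hurwitz's theorem applies
  (\<open>coeff_half_plane\<close>).

  Secondly, a nonzero palindromic polynomial with nonnegative coefficients and only real roots is
  \<open>\<gamma>\<close>-positive (\<open>gamma_positive_symmetric_stable\<close>): up to a power of the variable, it is a
  positive constant times factors \<open>x + 1\<close> and \<open>(x - r) (x - 1/r)\<close> with \<open>r < 0\<close>, and these are
  \<open>\<gamma>\<close>-positive.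
\<close>

section \<open>Coefficients of polynomials without zeros in a half-plane\<close>

lemma uniform_limit_sum:
  fixes f :: "'i \<Rightarrow> 'n \<Rightarrow> 'a \<Rightarrow> 'b::real_normed_vector"
  assumes "\<And>i. i \<in> I \<Longrightarrow> uniform_limit K (f i) (l i) F"
  shows "uniform_limit K (\<lambda>n t. \<Sum>i\<in>I. f i n t) (\<lambda>t. \<Sum>i\<in>I. l i t) F"
  using assms
  by (induction I rule: infinite_finite_induct)
    (simp_all add: uniform_limit_const uniform_limit_add)

text \<open>Hurwitz's theorem for combinations of fixed polynomials with convergent coefficients. In the
  constant case of that theorem, a constant limit that vanishes on \<open>S\<close> is the zero polynomial,
  because \<open>S\<close> is infinite.\<close>

lemma Hurwitz_poly_combination:
  fixes q :: "nat \<Rightarrow> complex poly"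
  assumes S: "open S" "connected S" "S \<noteq> {}"
    and lim: "\<And>k. k \<le> m \<Longrightarrow> (\<lambda>n. c n k) \<longlonglongrightarrow> l k"
    and nz: "\<And>n t. t \<in> S \<Longrightarrow> (\<Sum>k\<le>m. c n k * poly (q k) t) \<noteq> 0"
  shows "(\<Sum>k\<le>m. smult (l k) (q k)) = 0 \<or>
         (\<forall>t\<in>S. poly (\<Sum>k\<le>m. smult (l k) (q k)) t \<noteq> 0)"
proof (cases "(\<lambda>t. poly (\<Sum>k\<le>m. smult (l k) (q k)) t) constant_on S")
  case True
  then obtain a where a: "\<And>t. t \<in> S \<Longrightarrow> poly (\<Sum>k\<le>m. smult (l k) (q k)) t = a"
    by (auto simp: constant_on_def)
  have "infinite S"
    using S finite_imp_not_open by blast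
  then have "(\<Sum>k\<le>m. smult (l k) (q k)) = 0" if "a = 0"
    using a that poly_roots_finite[of "\<Sum>k\<le>m. smult (l k) (q k)"]
    by (metis (mono_tags, lifting) finite_subset mem_Collect_eq subsetI)
  with a show ?thesis by auto
next
  case False
  have ul: "uniform_limit K (\<lambda>n t. \<Sum>k\<le>m. c n k * poly (q k) t)
      (\<lambda>t. poly (\<Sum>k\<le>m. smult (l k) (q k)) t) sequentially"
    if "compact K" for K
  proof -
    have "uniform_limit K (\<lambda>n t. \<Sum>k\<le>m. c n k * poly (q k) t)
        (\<lambda>t. \<Sum>k\<le>m. l k * poly (q k) t) sequentially"
    proof (intro uniform_limit_sum uniform_lim_mult uniform_limit_const)
      fix k assume k: "k \<in> {..m}"
      show "uniform_limit K (\<lambda>n _. c n k) (\<lambda>_. l k) sequentially"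
        using lim[of k] k by (auto simp: uniform_limit_iff tendsto_iff eventually_mono)
      show "bounded ((\<lambda>_. l k) ` K)"
        by (rule finite_imp_bounded) (auto intro: finite_subset[of _ "{l k}"])
      show "bounded ((\<lambda>t. poly (q k) t) ` K)"
        by (intro compact_imp_bounded compact_continuous_image that continuous_intros)
    qed
    then show ?thesis by (simp add: poly_sum)
  qed
  have "poly (\<Sum>k\<le>m. smult (l k) (q k)) t \<noteq> 0" if "t \<in> S" for t
    by (rule Hurwitz_no_zeros[OF S(1,2) _ _ _ False nz that])
      (auto intro!: holomorphic_intros ul)
  then show ?thesis by blast
qed

text \<open>The Gauss-Lucas argument for the half-plane \<open>Im (w z) > 0\<close>: the logarithmic derivative is the
  sum of \<open>1 / (z - a)\<close> over the roots \<open>a\<close>, and after division by \<open>w\<close> every summand has negative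
  imaginary part.\<close>

lemma Im_log_derivative_nonpos:
  fixes f :: "complex poly"
  assumes "\<And>z. Im (w * z) > 0 \<Longrightarrow> poly f z \<noteq> 0" and "Im (w * z) > 0"
  shows "Im (poly (pderiv f) z / poly f z / w) \<le> 0 \<and>
         (degree f > 0 \<longrightarrow> Im (poly (pderiv f) z / poly f z / w) < 0)"
  using assms(1)
proof (induction "degree f" arbitrary: f)
  case 0
  then obtain a where "f = [:a:]" by (metis degree_0_id degree_eq_zeroE)
  then show ?case by simp
next
  case (Suc n)
  then have "\<not> constant (poly f)"
    by (simp add: constant_degree)
  then obtain a where a: "poly f a = 0"
    using fundamental_theorem_of_algebra by blast
  then obtain g where f: "f = [:-a, 1:] * g"
    using poly_eq_0_iff_dvd dvdE by metis
  have "f \<noteq> 0" using Suc.hyps(2) by auto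
  then have g0: "g \<noteq> 0" using f by auto
  have "degree f = Suc (degree g)"
    unfolding f using g0 by (subst degree_mult_eq) simp_all
  then have dg: "n = degree g" using Suc.hyps(2) by simp
  have g: "poly g z \<noteq> 0" if "Im (w * z) > 0" for z
    using Suc.prems[OF that] f by auto
  have za: "z - a \<noteq> 0" "poly g z \<noteq> 0"
    using Suc.prems[OF assms(2)] f by auto
  have "Im (w * a) \<le> 0" using Suc.prems[of a] a by force
  then have pos: "Im (w * (z - a)) > 0"
    using assms(2) by (simp add: algebra_simps)
  then have neg: "Im (1 / (w * (z - a))) < 0"
    by (simp add: Im_divide divide_neg_pos sum_power2_gt_zero_iff)
  have "w \<noteq> 0" using assms(2) by auto
  have pd: "poly (pderiv f) z = poly g z + (z - a) * poly (pderiv g) z"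
    unfolding f pderiv_mult by (simp add: pderiv_pCons algebra_simps)
  have pf: "poly f z = (z - a) * poly g z"
    unfolding f by (simp add: algebra_simps)
  have eq: "poly (pderiv f) z / poly f z / w
      = 1 / (w * (z - a)) + poly (pderiv g) z / poly g z / w"
    using za \<open>w \<noteq> 0\<close> unfolding pd pf by (simp add: divide_simps)
  show ?case
    using Suc.hyps(1)[OF dg g] neg unfolding eq by simp
qed

lemma higher_pderiv_half_plane:
  fixes f :: "complex poly"
  assumes "\<And>z. Im (w * z) > 0 \<Longrightarrow> poly f z \<noteq> 0" and "i \<le> degree f" and "Im (w * z) > 0"
  shows "poly ((pderiv ^^ i) f) z \<noteq> 0"
  using assms(2,3)
proof (induction i arbitrary: z)
  case 0
  then show ?case using assms(1) by simp
next
  case (Suc i)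
  let ?g = "(pderiv ^^ i) f"
  have "degree ?g > 0"
    using Suc.prems(1) by (simp add: degree_higher_pderiv)
  moreover have "\<And>z. Im (w * z) > 0 \<Longrightarrow> poly ?g z \<noteq> 0"
    using Suc by simp
  ultimately have "Im (poly (pderiv ?g) z / poly ?g z / w) < 0"
    using Im_log_derivative_nonpos[of w ?g z] Suc.prems by blast
  then show ?case by auto
qed

lemma poly_eq_sum_le:
  fixes x :: "'a::comm_semiring_1"
  assumes "degree p \<le> n"
  shows "poly p x = (\<Sum>i\<le>n. coeff p i * x ^ i)"
proof -
  have "(\<Sum>i\<le>degree p. coeff p i * x ^ i) = (\<Sum>i\<le>n. coeff p i * x ^ i)"
    by (rule sum.mono_neutral_left) (use assms in \<open>auto simp: coeff_eq_0\<close>)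
  then show ?thesis by (simp add: poly_altdef)
qed

lemma poly_map_poly_sum:
  fixes f :: "'b::zero \<Rightarrow> 'a::comm_semiring_1"
  assumes "f 0 = 0" "degree p \<le> n"
  shows "poly (map_poly f p) c = (\<Sum>i\<le>n. f (coeff p i) * c ^ i)"
proof -
  have "degree (map_poly f p) \<le> n"
    using assms map_poly_degree_leq[of f p] by linarith
  then have "poly (map_poly f p) c = (\<Sum>i\<le>n. coeff (map_poly f p) i * c ^ i)"
    by (rule poly_eq_sum_le)
  then show ?thesis using assms(1) by (simp add: coeff_map_poly)
qed

text \<open>In \<open>P\<close> the outer variable is \<open>z\<close> and the inner one is \<open>t\<close>. The condition \<open>Im w > 0\<close> says that
  the half-plane \<open>Im (w z) > 0\<close> contains the positive reals; this half-plane may depend on \<open>t\<close>.\<close>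

lemma coeff_half_plane:
  fixes P :: "complex poly poly"
  assumes "\<And>t. Im t > 0 \<Longrightarrow>
    \<exists>w. Im w > 0 \<and> (\<forall>z. Im (w * z) > 0 \<longrightarrow> poly (map_poly (\<lambda>q. poly q t) P) z \<noteq> 0)"
  shows "coeff P i = 0 \<or> (\<forall>t. Im t > 0 \<longrightarrow> poly (coeff P i) t \<noteq> 0)"
proof (cases "i \<le> degree P \<and> P \<noteq> 0")
  case False
  then show ?thesis by (auto simp: coeff_eq_0)
next
  case i: True
  define H where "H = {t. Im t > 0}"
  define F where "F t = map_poly (\<lambda>q. poly q t) P" for t
  define m where "m = degree P"
  have H: "open H" "connected H" "H \<noteq> {}"
    unfolding H_def
    by (auto simp: open_halfspace_Im_gt convex_connected convex_halfspace_Im_gt intro: exI[of _ \<i>])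
  have cF: "coeff (F t) k = poly (coeff P k) t" for t k
    unfolding F_def by (simp add: coeff_map_poly)
  have nzF: "poly ((pderiv ^^ j) (F t)) (of_real e) \<noteq> 0"
    if t: "t \<in> H" "j \<le> degree (F t)" "e > 0" for t j and e :: real
  proof -
    obtain w where w: "Im w > 0" "\<And>z. Im (w * z) > 0 \<Longrightarrow> poly (F t) z \<noteq> 0"
      using assms[of t] t(1) unfolding H_def F_def by blast
    show ?thesis
      by (rule higher_pderiv_half_plane[OF w(2) t(2)]) (use w(1) t(3) in auto)
  qed
  have degF_le: "degree (F t) \<le> m" for t
    unfolding F_def m_def by (rule map_poly_degree_leq)

  \<comment> \<open>Letting z tend to infinity shows that the degree in z is the same for all t in H. Hence no
    derivative of order at most m vanishes identically for some t in H.\<close>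
  have top: "poly (coeff P m) t \<noteq> 0" if "t \<in> H" for t
  proof -
    define c where "c n k = (1 / of_nat (Suc n) :: complex) ^ (m - k)" for n k :: nat
    define l where "l k = (if k = m then 1 else 0 :: complex)" for k :: nat
    have lim: "(\<lambda>n. c n k) \<longlonglongrightarrow> l k" if "k \<le> m" for k
    proof (cases "k = m")
      case False
      have "(\<lambda>n. (1 / of_nat (Suc n)) ^ (m - k) :: complex) \<longlonglongrightarrow> 0 ^ (m - k)"
        by (intro tendsto_intros) (use LIMSEQ_inverse_real_of_nat lim_1_over_n LIMSEQ_Suc in blast)
      moreover have "(0 :: complex) ^ (m - k) = 0" using False that by simp
      ultimately show ?thesis using False by (simp only: c_def l_def if_False)
    qed (simp add: c_def l_def)
    have nz: "(\<Sum>k\<le>m. c n k * poly (coeff P k) t) \<noteq> 0" if "t \<in> H" for n t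
    proof -
      let ?N = "of_nat (Suc n) :: complex"
      have "?N ^ m * (\<Sum>k\<le>m. c n k * poly (coeff P k) t)
          = (\<Sum>k\<le>m. poly (coeff P k) t * ?N ^ k)"
        unfolding sum_distrib_left c_def
        by (intro sum.cong refl)
          (simp add: power_diff power_divide del: of_nat_Suc)
      also have "\<dots> = poly (F t) ?N"
        using poly_eq_sum_le[OF degF_le, of t ?N] by (simp add: cF)
      also have "\<dots> \<noteq> 0"
        using nzF[OF that, of 0 "real (Suc n)"] by simp
      finally show ?thesis by auto
    qed
    have "(\<Sum>k\<le>m. smult (l k) (coeff P k)) = coeff P m"
      unfolding l_def by (simp add: if_distrib[of "\<lambda>a. smult a _"] sum.delta cong: if_cong)
    moreover have "coeff P m \<noteq> 0" using i by (simp add: m_def)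
    ultimately show ?thesis
      using Hurwitz_poly_combination[OF H lim nz] that by simp
  qed
  have degF: "degree (F t) = m" if "t \<in> H" for t
    using top[OF that] degF_le[of t] cF[of t m] le_degree[of "F t" m] by simp

  \<comment> \<open>Letting z tend to zero in the derivative of order i isolates the coefficient of order i.\<close>
  define c where
    "c n k = pochhammer (of_nat (Suc k)) i * (1 / of_nat (Suc n) :: complex) ^ k" for n k :: nat
  define l where "l k = (if k = 0 then pochhammer 1 i else 0 :: complex)" for k :: nat
  have lim: "(\<lambda>n. c n k) \<longlonglongrightarrow> l k" if "k \<le> m - i" for k
  proof (cases "k = 0")
    case False
    have "(\<lambda>n. pochhammer (of_nat (Suc k)) i * (1 / of_nat (Suc n)) ^ k :: complex)
        \<longlonglongrightarrow> pochhammer (of_nat (Suc k)) i * 0 ^ k"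
      by (intro tendsto_intros) (use lim_1_over_n LIMSEQ_Suc in blast)
    moreover have "(0 :: complex) ^ k = 0" using False by simp
    ultimately show ?thesis using False by (simp only: c_def l_def if_False mult_zero_right)
  qed (simp add: c_def l_def)
  have nz: "(\<Sum>k\<le>m - i. c n k * poly (coeff P (k + i)) t) \<noteq> 0" if "t \<in> H" for n t
  proof -
    have "degree ((pderiv ^^ i) (F t)) \<le> m - i"
      using degF[OF that] by (simp add: degree_higher_pderiv)
    from poly_eq_sum_le[OF this, of "1 / of_nat (Suc n)"]
    have "(\<Sum>k\<le>m - i. c n k * poly (coeff P (k + i)) t)
        = poly ((pderiv ^^ i) (F t)) (1 / of_nat (Suc n))"
      by (simp add: coeff_higher_pderiv cF c_def mult_ac)
    also have "\<dots> \<noteq> 0"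
      using nzF[OF that, of i "1 / real (Suc n)"] degF[OF that] i by (simp add: m_def)
    finally show ?thesis .
  qed
  have "(\<Sum>k\<le>m - i. smult (l k) (coeff P (k + i))) = smult (pochhammer 1 i) (coeff P i)"
    unfolding l_def by (simp add: if_distrib[of "\<lambda>a. smult a _"] sum.delta cong: if_cong)
  then show ?thesis
    using Hurwitz_poly_combination[OF H lim nz] by (auto simp: H_def pochhammer_fact[symmetric])
qed

section \<open>Real-rooted palindromic polynomials\<close>

text \<open>Univariate \<open>\<gamma>\<close>-positivity with centre of symmetry \<open>N/2\<close>; this is homogeneous
  \<open>\<gamma>\<close>-positivity of degree \<open>N\<close> with the second variable set to 1.\<close>

definition gamma_positive :: "nat \<Rightarrow> real poly \<Rightarrow> bool" where
  "gamma_positive N A \<longleftrightarrow> (\<exists>\<gamma>. (\<forall>k. \<gamma> k \<ge> 0) \<and>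
     A = (\<Sum>k = 0..N div 2. smult (\<gamma> k) ([:0, 1:] ^ k * [:1, 1:] ^ (N - 2 * k))))"

lemma gamma_positive_0 [simp]: "gamma_positive N 0"
  unfolding gamma_positive_def by (rule exI[of _ "\<lambda>_. 0"]) simp

lemma gamma_positive_add:
  assumes "gamma_positive N A" "gamma_positive N B"
  shows "gamma_positive N (A + B)"
proof -
  from assms obtain \<gamma> \<delta> :: "nat \<Rightarrow> real" where
    "\<And>k. \<gamma> k \<ge> 0" "\<And>k. \<delta> k \<ge> 0"
    "A = (\<Sum>k = 0..N div 2. smult (\<gamma> k) ([:0, 1:] ^ k * [:1, 1:] ^ (N - 2 * k)))"
    "B = (\<Sum>k = 0..N div 2. smult (\<delta> k) ([:0, 1:] ^ k * [:1, 1:] ^ (N - 2 * k)))"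
    unfolding gamma_positive_def by blast
  then show ?thesis
    unfolding gamma_positive_def
    by (intro exI[of _ "\<lambda>k. \<gamma> k + \<delta> k"]) (simp add: sum.distrib smult_add_left)
qed

lemma gamma_positive_sum:
  assumes "\<And>i. i \<in> I \<Longrightarrow> gamma_positive N (f i)"
  shows "gamma_positive N (sum f I)"
  using assms by (induction I rule: infinite_finite_induct) (simp_all add: gamma_positive_add)

lemma gamma_positive_basis:
  assumes "c \<ge> 0" "2 * k \<le> N"
  shows "gamma_positive N (smult c ([:0, 1:] ^ k * [:1, 1:] ^ (N - 2 * k)))"
  unfolding gamma_positive_def
  by (rule exI[of _ "\<lambda>j. if j = k then c else 0"])
    (use assms in \<open>auto simp: if_distrib[of "\<lambda>a. smult a _"] sum.delta cong: if_cong\<close>)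

lemma gamma_positive_mult_basis:
  assumes "gamma_positive N A" "c \<ge> 0" "2 * j \<le> M"
  shows "gamma_positive (N + M) (smult c ([:0, 1:] ^ j * [:1, 1:] ^ (M - 2 * j)) * A)"
proof -
  from assms(1) obtain \<gamma> :: "nat \<Rightarrow> real" where \<gamma>: "\<And>k. \<gamma> k \<ge> 0"
    "A = (\<Sum>k = 0..N div 2. smult (\<gamma> k) ([:0, 1:] ^ k * [:1, 1:] ^ (N - 2 * k)))"
    unfolding gamma_positive_def by blast
  have "smult c ([:0, 1:] ^ j * [:1, 1:] ^ (M - 2 * j)) * A
      = (\<Sum>k = 0..N div 2. smult (c * \<gamma> k)
          ([:0, 1:] ^ (j + k) * [:1, 1:] ^ ((N + M) - 2 * (j + k))))"
    unfolding \<gamma>(2) sum_distrib_left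
  proof (intro sum.cong refl)
    fix k assume "k \<in> {0..N div 2}"
    then have "(N + M) - 2 * (j + k) = (M - 2 * j) + (N - 2 * k)"
      using assms(3) by auto
    then show "smult c ([:0, 1:] ^ j * [:1, 1:] ^ (M - 2 * j)) *
        smult (\<gamma> k) ([:0, 1:] ^ k * [:1, 1:] ^ (N - 2 * k))
      = smult (c * \<gamma> k) ([:0, 1:] ^ (j + k) * [:1, 1:] ^ ((N + M) - 2 * (j + k)))"
      by (simp only: power_add mult_smult_left mult_smult_right smult_smult mult_ac)
  qed
  moreover have "gamma_positive (N + M) \<dots>"
    by (intro gamma_positive_sum gamma_positive_basis) (use assms \<gamma>(1) in auto)
  ultimately show ?thesis by simp
qed

text \<open>Roots of a palindromic polynomial come in pairs \<open>r\<close>, \<open>1/r\<close>. For \<open>r < 0\<close> such a pair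
  contributes the factor \<open>(1 + x)\<^sup>2 + (- r - 1/r - 2) x\<close>, whose last coefficient is nonnegative.\<close>

lemma gamma_positive_palindromic:
  fixes B :: "real poly"
  assumes "reflect_poly B = B" "coeff B 0 > 0"
    and "\<And>z. poly (map_poly complex_of_real B) z = 0 \<Longrightarrow> \<exists>r<0. z = complex_of_real r"
  shows "gamma_positive (degree B) B"
  using assms
proof (induction "degree B" arbitrary: B rule: less_induct)
  case less
  have [simp]: "B \<noteq> 0" using less.prems(2) by auto
  have mapmult: "map_poly complex_of_real (p * q)
      = map_poly complex_of_real p * map_poly complex_of_real q" for p q
    by (intro poly_eqI) (simp add: coeff_map_poly coeff_mult)
  show ?case
  proof (cases "degree B = 0")
    case True
    then obtain a where "B = [:a:]" by (rule degree_eq_zeroE)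
    then show ?thesis
      using gamma_positive_basis[of a 0 0] less.prems(2) by simp
  next
    case False
    have "\<not> constant (poly (map_poly complex_of_real B))"
      using False by (simp add: constant_degree degree_map_poly)
    then obtain z where z: "poly (map_poly complex_of_real B) z = 0"
      using fundamental_theorem_of_algebra by blast
    then obtain r where r: "r < 0" "z = complex_of_real r"
      using less.prems(3) by blast
    have of_real_poly: "poly (map_poly complex_of_real p) (complex_of_real x)
        = complex_of_real (poly p x)" for p x
      by (induction p) (simp_all add: map_poly_pCons)
    have "poly B r = 0"
      using z r(2) of_real_poly by simp
    then obtain C where C: "B = [:-r, 1:] * C"
      using poly_eq_0_iff_dvd dvdE by metis
    then have C0: "C \<noteq> 0" using \<open>B \<noteq> 0\<close> by auto
    have dC: "degree B = degree C + 1"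
      unfolding C using C0 by (subst degree_mult_eq) simp_all
    show ?thesis
    proof (cases "r = -1")
      case True
      then have BC: "B = [:1, 1:] * C" using C by simp
      have "reflect_poly [:1, 1 :: real:] = [:1, 1:]"
        by (simp add: reflect_poly_def)
      then have "[:1, 1:] * reflect_poly C = [:1, 1:] * C"
        using less.prems(1) unfolding BC by (simp only: reflect_poly_mult)
      then have "reflect_poly C = C"
        by (metis mult_cancel_left pCons_eq_0_iff one_neq_zero)
      moreover have "coeff C 0 > 0" using less.prems(2) BC by (simp add: coeff_mult)
      moreover have "\<exists>r<0. z = complex_of_real r" if "poly (map_poly complex_of_real C) z = 0" for z
        using less.prems(3)[of z] that unfolding BC mapmult by simp
      ultimately have "gamma_positive (degree C) C"
        using less.hyps[of C] dC by simp
      then show ?thesis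
        using gamma_positive_mult_basis[of "degree C" C 1 0 1] dC BC by simp
    next
      case False
      have "r * r \<noteq> 1" using False r(1)
        by (metis less_irrefl less_numeral_extra(1) order.strict_trans square_eq_1_iff)
      then have rne: "inverse r - r \<noteq> 0" using r(1) by (auto simp: field_simps)
      have "poly B (inverse r) = 0"
        using poly_reflect_poly_nz[of r B] r(1) \<open>poly B r = 0\<close> less.prems(1) by simp
      then have "poly C (inverse r) = 0" using rne unfolding C by auto
      then obtain D where D: "C = [:-inverse r, 1:] * D"
        using poly_eq_0_iff_dvd dvdE by metis
      then have D0: "D \<noteq> 0" using C0 by auto
      define b where "b = - r - inverse r"
      have "b - 2 = (r + 1) ^ 2 / (- r)"
        using r(1) by (simp add: b_def field_simps power2_eq_square)
      then have b: "b \<ge> 2" using r(1)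
        by (metis diff_ge_0_iff_ge divide_nonneg_pos neg_0_less_iff_less zero_le_power2)
      have BD: "B = [:1, b, 1:] * D"
        unfolding C D mult.assoc[symmetric]
        using r(1) by (simp add: b_def minus_diff_commute)
      have dD: "degree B = degree D + 2"
        unfolding BD using D0 by (subst degree_mult_eq) simp_all
      have "reflect_poly [:1, b, 1 :: real:] = [:1, b, 1:]"
        by (simp add: reflect_poly_def)
      then have "[:1, b, 1:] * reflect_poly D = [:1, b, 1:] * D"
        using less.prems(1) unfolding BD by (simp only: reflect_poly_mult)
      then have "reflect_poly D = D"
        by (metis mult_cancel_left pCons_eq_0_iff one_neq_zero)
      moreover have "coeff D 0 > 0" using less.prems(2) BD by (simp add: coeff_mult)
      moreover have "\<exists>r<0. z = complex_of_real r" if "poly (map_poly complex_of_real D) z = 0" for z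
        using less.prems(3)[of z] that unfolding BD mapmult by simp
      ultimately have "gamma_positive (degree D) D"
        using less.hyps[of D] dD by simp
      then have "gamma_positive (degree D + 2) (smult 1 ([:0, 1:] ^ 0 * [:1, 1:] ^ (2 - 2 * 0)) * D)"
        "gamma_positive (degree D + 2) (smult (b - 2) ([:0, 1:] ^ 1 * [:1, 1:] ^ (2 - 2 * 1)) * D)"
        using b by (intro gamma_positive_mult_basis; simp)+
      from gamma_positive_add[OF this]
      have "gamma_positive (degree B) ((smult 1 ([:0, 1:] ^ 0 * [:1, 1:] ^ (2 - 2 * 0))
          + smult (b - 2) ([:0, 1:] ^ 1 * [:1, 1:] ^ (2 - 2 * 1))) * D)"
        unfolding dD by (simp only: distrib_right)
      moreover have "smult 1 ([:0, 1:] ^ 0 * [:1, 1:] ^ (2 - 2 * 0))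
          + smult (b - 2) ([:0, 1:] ^ 1 * [:1, 1:] ^ (2 - 2 * 1)) = [:1, b, 1:]"
        by (simp add: power2_eq_square)
      ultimately show ?thesis by (simp only: BD)
    qed
  qed
qed

text \<open>The degree of \<open>A\<close> may be less than \<open>N\<close>. By symmetry it is \<open>N - k\<close>, where \<open>k\<close> is the order of the
  root 0, and removing the factor \<open>x\<^sup>k\<close> leaves a polynomial that equals its own reflection.\<close>

lemma gamma_positive_symmetric_stable:
  fixes A :: "real poly"
  assumes nonneg: "\<And>j. coeff A j \<ge> 0"
    and deg: "degree A \<le> N"
    and sym: "\<And>j. j \<le> N \<Longrightarrow> coeff A j = coeff A (N - j)"
    and stable: "A = 0 \<or> (\<forall>t. Im t > 0 \<longrightarrow> poly (map_poly complex_of_real A) t \<noteq> 0)"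
  shows "gamma_positive N A"
proof (cases "A = 0")
  case False
  obtain B where AB: "A = [:0, 1:] ^ order 0 A * B" and "\<not> [:0, 1:] dvd B"
    using order_decomp[OF False, of 0] by auto
  then have B0: "coeff B 0 \<noteq> 0"
    by (metis poly_eq_0_iff_dvd minus_zero poly_0_coeff_0)
  define k where "k = order 0 A"
  have A: "A = monom 1 k * B"
    using AB by (simp add: k_def monom_altdef)
  have cA: "coeff A j = (if j < k then 0 else coeff B (j - k))" for j
    unfolding A by (simp add: coeff_monom_mult)
  have "coeff A k \<noteq> 0" using B0 cA by simp
  then have kN: "k \<le> N" using deg le_degree by fastforce
  have dA: "degree A = N - k"
  proof (rule antisym)
    show "degree A \<le> N - k"
    proof (rule degree_le, intro allI impI)
      fix j assume "N - k < j"
      then show "coeff A j = 0"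
        using sym[of j] cA[of "N - j"] deg coeff_eq_0[of A j] kN by (cases "j \<le> N") auto
    qed
    show "N - k \<le> degree A"
      using \<open>coeff A k \<noteq> 0\<close> sym[OF kN] by (simp add: le_degree)
  qed
  have "B \<noteq> 0" using B0 by auto
  then have "degree A = k + degree B"
    unfolding A by (simp add: degree_mult_eq degree_monom_eq)
  with dA kN have N: "N = 2 * k + degree B" by auto
  have "reflect_poly B = B"
  proof (rule poly_eqI)
    fix j
    show "coeff (reflect_poly B) j = coeff B j"
    proof (cases "j \<le> degree B")
      case True
      then have "coeff B j = coeff A (j + k)" "coeff B (degree B - j) = coeff A (N - (j + k))"
        using N by (auto simp: cA)
      then show ?thesis using sym[of "j + k"] True N by (simp add: coeff_reflect_poly)
    qed (simp add: coeff_reflect_poly coeff_eq_0)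
  qed
  moreover have nnB: "coeff B j \<ge> 0" for j
    using nonneg[of "j + k"] by (simp add: cA)
  then have "coeff B 0 > 0" using B0 by (simp add: order_less_le)
  moreover have "\<exists>r<0. z = complex_of_real r" if z: "poly (map_poly complex_of_real B) z = 0" for z
  proof -
    have Az: "poly (map_poly complex_of_real A) z = 0"
      if "poly (map_poly complex_of_real B) z = 0" for z
    proof -
      have "map_poly complex_of_real A = monom 1 k * map_poly complex_of_real B"
        by (intro poly_eqI) (simp add: coeff_map_poly coeff_monom_mult cA)
      with that show ?thesis by simp
    qed
    have "poly (map_poly complex_of_real B) (cnj z) = 0"
      using z by (subst real_poly_cnj_root_iff) (auto simp: coeff_map_poly)
    then have "\<not> Im z > 0" "\<not> Im (cnj z) > 0"
      using Az z stable False by blast+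
    then have "Im z = 0" by simp
    then have zr: "z = complex_of_real (Re z)" by (simp add: complex_eq_iff)
    have "poly (map_poly complex_of_real B) (complex_of_real x) = complex_of_real (poly B x)" for x
      by (induction B) (simp_all add: map_poly_pCons)
    then have "poly B (Re z) = 0" using z zr by (metis of_real_eq_0_iff)
    moreover have "poly B x > 0" if "x \<ge> 0" for x
      unfolding poly_altdef
      by (rule sum_pos2[of _ 0]) (use \<open>coeff B 0 > 0\<close> nnB that in auto)
    ultimately have "Re z < 0" by (metis not_less less_irrefl)
    with zr show ?thesis by blast
  qed
  ultimately have "gamma_positive (degree B) B" by (rule gamma_positive_palindromic)
  from gamma_positive_mult_basis[OF this, of 1 k "2 * k"]
  show ?thesis using N AB by (simp add: k_def add.commute)
qed simp

section \<open>Homogeneous polynomials\<close>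

text \<open>All monomials of \<open>h\<close> have total degree \<open>N\<close>; the zero polynomial is homogeneous of every
  degree.\<close>

definition homogeneous2 :: "nat \<Rightarrow> bipoly \<Rightarrow> bool" where
  "homogeneous2 N h \<longleftrightarrow> (\<forall>i j. coeff (coeff h j) i \<noteq> 0 \<longrightarrow> i + j = N)"

lemma homogeneous2_sum:
  assumes "\<And>a. a \<in> I \<Longrightarrow> homogeneous2 N (f a)"
  shows "homogeneous2 N (sum f I)"
  unfolding homogeneous2_def
proof (intro allI impI)
  fix i j assume "coeff (coeff (sum f I) j) i \<noteq> 0"
  then obtain a where "a \<in> I" "coeff (coeff (f a) j) i \<noteq> 0"
    unfolding coeff_sum by (meson sum.not_neutral_contains_not_neutral)
  then show "i + j = N" using assms unfolding homogeneous2_def by blast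
qed

lemma homogeneous2_mult:
  assumes "homogeneous2 M g" "homogeneous2 N h"
  shows "homogeneous2 (M + N) (g * h)"
  unfolding homogeneous2_def
proof (intro allI impI)
  fix i j assume "coeff (coeff (g * h) j) i \<noteq> 0"
  then have "(\<Sum>b\<le>j. \<Sum>a\<le>i. coeff (coeff g b) a * coeff (coeff h (j - b)) (i - a)) \<noteq> 0"
    by (simp add: coeff_mult coeff_sum)
  then obtain a b where "b \<le> j" "a \<le> i" "coeff (coeff g b) a * coeff (coeff h (j - b)) (i - a) \<noteq> 0"
    by (meson atMost_iff sum.not_neutral_contains_not_neutral)
  then have "b \<le> j" "a \<le> i" "a + b = M" "(i - a) + (j - b) = N"
    using assms unfolding homogeneous2_def by (simp_all del: diff_diff_left)
  then show "i + j = M + N" by simp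
qed

lemma homogeneous2_power: "homogeneous2 N h \<Longrightarrow> homogeneous2 (n * N) (h ^ n)"
proof (induction n)
  case 0
  then show ?case by (auto simp: homogeneous2_def coeff_1)
next
  case (Suc n)
  then show ?case using homogeneous2_mult[of N h] by simp
qed

text \<open>Setting the outer variable to 1 loses no information on a homogeneous polynomial.\<close>

lemma coeff_poly_1_homogeneous2:
  assumes "homogeneous2 N h"
  shows "coeff (poly h 1) i = (if i \<le> N then coeff (coeff h (N - i)) i else 0)"
proof -
  have "coeff (poly h 1) i = (\<Sum>j\<le>max N (degree h). coeff (coeff h j) i)"
    by (subst poly_eq_sum_le[of h "max N (degree h)"]) (simp_all add: coeff_sum)
  also have "\<dots> = (\<Sum>j\<le>max N (degree h). if j = N - i \<and> i \<le> N then coeff (coeff h j) i else 0)"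
  proof (intro sum.cong refl)
    fix j
    have "coeff (coeff h j) i = 0 \<or> i + j = N"
      using assms unfolding homogeneous2_def by blast
    then show "coeff (coeff h j) i = (if j = N - i \<and> i \<le> N then coeff (coeff h j) i else 0)"
      by auto
  qed
  also have "\<dots> = (if i \<le> N then coeff (coeff h (N - i)) i else 0)"
    by (cases "i \<le> N") (simp_all add: sum.delta le_max_iff_disj)
  finally show ?thesis .
qed

lemma homogeneous2_eqI:
  assumes "homogeneous2 N g" "homogeneous2 N h" "poly g 1 = poly h 1"
  shows "g = h"
proof (intro poly_eqI)
  fix i j
  show "coeff (coeff g j) i = coeff (coeff h j) i"
  proof (cases "i + j = N")
    case True
    then have "N - i = j" "i \<le> N" by auto
    then show ?thesis
      using coeff_poly_1_homogeneous2[OF assms(1), of i]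
        coeff_poly_1_homogeneous2[OF assms(2), of i] assms(3) by simp
  next
    case False
    then have "coeff (coeff g j) i = 0" "coeff (coeff h j) i = 0"
      using assms(1,2) unfolding homogeneous2_def by blast+
    then show ?thesis by simp
  qed
qed

lemma homogeneous_gamma_positiveI:
  assumes "homogeneous2 N h" "gamma_positive N (poly h 1)"
  shows "homogeneous_gamma_positive h"
proof -
  define x y :: bipoly where "x = [:[:0, 1:]:]" and "y = [:0, 1:]"
  obtain \<gamma> :: "nat \<Rightarrow> real" where \<gamma>: "\<And>k. \<gamma> k \<ge> 0"
    "poly h 1 = (\<Sum>k = 0..N div 2. smult (\<gamma> k) ([:0, 1:] ^ k * [:1, 1:] ^ (N - 2 * k)))"
    using assms(2) unfolding gamma_positive_def by blast
  define g where "g = (\<Sum>k = 0..N div 2. [:[:\<gamma> k:]:] * (x * y) ^ k * (x + y) ^ (N - 2 * k))"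
  have "homogeneous2 N g"
    unfolding g_def
  proof (rule homogeneous2_sum)
    fix k assume k: "k \<in> {0..N div 2}"
    have "homogeneous2 0 [:[:\<gamma> k:]:]" "homogeneous2 2 (x * y)" "homogeneous2 1 (x + y)"
      by (auto simp: homogeneous2_def x_def y_def coeff_pCons split: nat.splits if_splits)
    then have "homogeneous2 ((0 + k * 2) + (N - 2 * k) * 1)
        ([:[:\<gamma> k:]:] * (x * y) ^ k * (x + y) ^ (N - 2 * k))"
      by (intro homogeneous2_mult homogeneous2_power)
    then show "homogeneous2 N ([:[:\<gamma> k:]:] * (x * y) ^ k * (x + y) ^ (N - 2 * k))"
      using k by (simp add: mult.commute)
  qed
  moreover have "poly h 1 = poly g 1"
    unfolding \<gamma>(2) g_def by (simp add: poly_sum poly_power x_def y_def one_pCons)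
  ultimately have "h = g" using assms(1) by (intro homogeneous2_eqI)
  with \<gamma>(1) show ?thesis
    unfolding homogeneous_gamma_positive_def Let_def g_def x_def y_def by blast
qed

lemma eval3_expand:
  assumes d: "\<And>i j k. coeff3 p i j k \<noteq> 0 \<Longrightarrow> i + j + k = d" and e: "e 0 = 0"
  shows "eval3 e p a b c =
    (\<Sum>k\<le>d. \<Sum>j\<le>d. \<Sum>i\<le>d. e (coeff3 p i j k) * a ^ i * b ^ j * c ^ k)"
proof -
  have deg1: "degree (coeff (coeff p k) j) \<le> d" for j k
    by (intro degree_le allI impI) (use d in \<open>fastforce simp: coeff3_def\<close>)
  have deg2: "degree (coeff p k) \<le> d" for k
    by (intro degree_le allI impI poly_eqI) (use d in \<open>fastforce simp: coeff3_def\<close>)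
  have deg3: "degree p \<le> d"
    by (intro degree_le allI impI poly_eqI) (use d in \<open>fastforce simp: coeff3_def\<close>)
  show ?thesis
    unfolding eval3_def
    by (simp add: poly_map_poly_sum[where n = d] deg1 deg2 deg3 e coeff3_def sum_distrib_right)
qed

lemma coeff3_symmetric:
  assumes "homogeneous3 p" "symmetric_xy p"
  shows "coeff3 p i j k = coeff3 p j i k"
proof -
  obtain d where d: "\<And>i j k. coeff3 p i j k \<noteq> 0 \<Longrightarrow> i + j + k = d"
    using assms(1) unfolding homogeneous3_def by blast
  define x y z :: tripoly where "x = [:[:[:0, 1:]:]:]" and "y = [:[:0, 1:]:]" and "z = [:0, 1:]"
  have mon: "[:[:[:c:]:]:] * y ^ i * x ^ j * z ^ k = monom (monom (monom c j) i) k" for c i j k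
    by (simp add: x_def y_def z_def poly_const_pow monom_altdef smult_smult)
  have sum_if: "(\<Sum>a\<le>d. if Q then f a else 0) = (if Q then \<Sum>a\<le>d. f a else 0)"
    for Q and f :: "nat \<Rightarrow> real"
    by simp
  have "p = eval3 (\<lambda>c. [:[:[:c:]:]:]) p y x z"
    using assms(2) unfolding symmetric_xy_def Let_def x_def y_def z_def .
  also have "\<dots> = (\<Sum>k\<le>d. \<Sum>j\<le>d. \<Sum>i\<le>d. [:[:[:coeff3 p i j k:]:]:] * y ^ i * x ^ j * z ^ k)"
    by (rule eval3_expand) (use d in auto)
  also have "\<dots> = (\<Sum>k\<le>d. \<Sum>j\<le>d. \<Sum>i\<le>d. monom (monom (monom (coeff3 p i j k) j) i) k)"
    by (simp only: mon)
  finally have "coeff3 p i j k = coeff3 \<dots> i j k" by simp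
  also have "\<dots> = (\<Sum>k'\<le>d. \<Sum>j'\<le>d. \<Sum>i'\<le>d.
      if k' = k then if j' = i then if i' = j then coeff3 p i' j' k' else 0 else 0 else 0)"
    unfolding coeff3_def coeff_sum by (intro sum.cong refl) auto
  also have "\<dots> = (if k \<le> d \<and> i \<le> d \<and> j \<le> d then coeff3 p j i k else 0)"
    by (simp add: sum_if sum.delta)
  also have "\<dots> = coeff3 p j i k"
    using d[of j i k] by (cases "coeff3 p j i k = 0") auto
  finally show ?thesis .
qed

lemma eval3_homogeneous:
  fixes c :: complex
  assumes d: "\<And>i j k. coeff3 p i j k \<noteq> 0 \<Longrightarrow> i + j + k = d"
  shows "eval3 complex_of_real p (c * x) (c * y) (c * z) = c ^ d * eval3 complex_of_real p x y z"
proof -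
  have eq: "complex_of_real (coeff3 p i j k) * (c * x) ^ i * (c * y) ^ j * (c * z) ^ k
      = c ^ d * (complex_of_real (coeff3 p i j k) * x ^ i * y ^ j * z ^ k)" for i j k
  proof (cases "coeff3 p i j k = 0")
    case False
    from d[OF this] show ?thesis by (auto simp: power_mult_distrib power_add)
  qed simp
  have expand: "eval3 complex_of_real p x y z =
      (\<Sum>k\<le>d. \<Sum>j\<le>d. \<Sum>i\<le>d. complex_of_real (coeff3 p i j k) * x ^ i * y ^ j * z ^ k)" for x y z
    by (rule eval3_expand) (use d in auto)
  show ?thesis
    by (simp only: expand sum_distrib_left eq)
qed

lemma stable3_coeff:
  assumes "homogeneous3 p" "stable3 p"
  shows "poly (coeff p k) 1 = 0 \<or>
    (\<forall>t. Im t > 0 \<longrightarrow> poly (map_poly complex_of_real (poly (coeff p k) 1)) t \<noteq> 0)"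
proof (cases "p = 0")
  case False
  obtain d where d: "\<And>i j k. coeff3 p i j k \<noteq> 0 \<Longrightarrow> i + j + k = d"
    using assms(1) unfolding homogeneous3_def by blast
  define P where "P = map_poly (\<lambda>s. map_poly complex_of_real (poly s 1)) p"
  have swap: "poly (map_poly (\<lambda>r. poly (map_poly complex_of_real r) t) s) 1
      = poly (map_poly complex_of_real (poly s 1)) t" for s t
  proof (induction s)
    case (pCons a s)
    have "map_poly complex_of_real (a + poly s 1)
        = map_poly complex_of_real a + map_poly complex_of_real (poly s 1)"
      by (intro poly_eqI) (simp add: coeff_map_poly)
    then show ?case using pCons by (simp add: map_poly_pCons)
  qed simp
  have eval: "poly (map_poly (\<lambda>q. poly q t) P) z = eval3 complex_of_real p t 1 z" for t z
    unfolding P_def eval3_def by (simp add: map_poly_map_poly o_def swap)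
  have "coeff P k = 0 \<or> (\<forall>t. Im t > 0 \<longrightarrow> poly (coeff P k) t \<noteq> 0)"
  proof (rule coeff_half_plane)
    fix t :: complex assume t: "Im t > 0"
    \<comment> \<open>Multiplication by w takes both 1 and t into the upper half-plane.\<close>
    define w where "w = Complex ((\<bar>Re t\<bar> + 1) / Im t) 1"
    have "Im (w * t) = \<bar>Re t\<bar> + 1 + Re t" using t by (simp add: w_def)
    then have wt: "Im (w * t) > 0" by simp
    have "poly (map_poly (\<lambda>q. poly q t) P) z \<noteq> 0" if "Im (w * z) > 0" for z
    proof -
      have "Im (w * 1) > 0" by (simp add: w_def)
      then have "eval3 complex_of_real p (w * t) (w * 1) (w * z) \<noteq> 0"
        using assms(2) False wt that unfolding stable3_def by blast
      then show ?thesis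
        unfolding eval using eval3_homogeneous[of p d w t 1 z, OF d] by auto
    qed
    then show "\<exists>w. Im w > 0 \<and>
        (\<forall>z. Im (w * z) > 0 \<longrightarrow> poly (map_poly (\<lambda>q. poly q t) P) z \<noteq> 0)"
      by (intro exI[of _ w]) (simp add: w_def)
  qed
  then show ?thesis
    unfolding P_def by (simp add: coeff_map_poly map_poly_eq_0_iff)
qed simp

theorem theorem3p1:
  fixes p :: tripoly
  assumes "homogeneous3 p"
    and "nonneg_coeffs3 p"
    and "stable3 p"
    and "symmetric_xy p"
  shows "partial_gamma_positive p"
proof -
  obtain d where d: "\<And>i j k. coeff3 p i j k \<noteq> 0 \<Longrightarrow> i + j + k = d"
    using assms(1) unfolding homogeneous3_def by blast
  have "homogeneous_gamma_positive (coeff p k)" for k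
  proof -
    \<comment> \<open>For k > d the coefficient is zero, so the truncated subtraction is harmless.\<close>
    define N where "N = d - k"
    have hom: "homogeneous2 N (coeff p k)"
      using d unfolding homogeneous2_def N_def coeff3_def by force
    have A: "coeff (poly (coeff p k) 1) i = (if i \<le> N then coeff3 p i (N - i) k else 0)" for i
      using coeff_poly_1_homogeneous2[OF hom] by (simp add: coeff3_def)
    have "gamma_positive N (poly (coeff p k) 1)"
    proof (rule gamma_positive_symmetric_stable)
      show "coeff (poly (coeff p k) 1) j \<ge> 0" for j
        using assms(2) by (simp add: A nonneg_coeffs3_def)
      show "degree (poly (coeff p k) 1) \<le> N"
        by (rule degree_le) (simp add: A)
      show "coeff (poly (coeff p k) 1) j = coeff (poly (coeff p k) 1) (N - j)" if "j \<le> N" for j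
        using that coeff3_symmetric[OF assms(1,4)] by (simp add: A)
    qed (rule stable3_coeff[OF assms(1,3)])
    with hom show ?thesis by (rule homogeneous_gamma_positiveI)
  qed
  then show ?thesis unfolding partial_gamma_positive_def by blast
qed

end
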